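(* Let $\mathcal S\subset l_\infty$ be the set of all GAS convergent sequences, with the topology induced by the norm $\|\cdot\|_\infty$. Then: (i) $\mathcal S$ is closed in $l_\infty$; (ii) $\mathcal S$ is non-separable; (iii) $\mathcal S$ is first countable but not second countable; (iv) $\mathcal S$ is not Lindelöf and not compact.
   Context: $l_\infty$ is the normed linear space of all bounded real sequences $x=(x_n)_{n\in\mathbb N}$, $\mathbb N=\{1,2,3,\dots\}$, with the norm $\|x\|_\infty=\sup_n|x_n|$. For $P\subset\mathbb N$, the natural density is $\delta(P)=\lim_{n\to\infty}\frac{|P\cap\{1,\dots,n\}|}{n}$ when the limit exists. A condition holds for "a.a.$k$" (almost all $k$) if the set $E$ of $k\in\mathbb N$ for which it fails has $\delta(E)=0$. A real sequence $(p_k)$ converges statistically to $\ell\in\mathbb R$, written $\mathrm{stat}\lim_{n\to\infty} p_n=\ell$, if for every $\epsilon>0$, $\delta(\{k\in\mathbb N:|p_k-\ell|>\epsilon\})=0$. $st\subset l_\infty$ is the subspace of all bounded statistically convergent real sequences, and $g:st\to\mathbb R$, $g(x)=\mathrm{stat}\lim_{n\to\infty}x_n$, is the statistical limit functional. $S$ is the shift operator $S((x_n)_{n=1}^\infty)=(x_n)_{n=2}^\infty$. A linear functional $\mathcal F:l_\infty\to\mathbb R$ is a Banach statistical limit functional if: (i) $\|\mathcal F\|=1$; (ii) $\mathcal F|_{st}=g$; (iii) if $s\in l_\infty$ with $s_n\ge0$ a.a.$n$, then $\mathcal F(s)\ge0$; (iv) for every $x\in l_\infty$, $\mathcal F(x)=\mathcal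 F(Tx)$ for every map $T:l_\infty\to l_\infty$ such that $(Ty)_k=(Sy)_k$ a.a.$k$ for each $y\in l_\infty$. A sequence $x\in l_\infty$ is generalized almost statistically (GAS) convergent to $\lambda$ if $\mathcal F(x)=\lambda$ for all Banach statistical limit functionals $\mathcal F$; it is GAS convergent if this holds for some $\lambda\in\mathbb R$. *)

theory Defs
  imports "HOL-Analysis.Analysis"
begin

(* The index set {1,2,3,...} is relabelled to nat by n |-> n - 1: the value of a sequence at
   (i :: nat) is its (i+1)-st term, and a set of indices is a set of type nat set whose initial
   segment {1,...,n} becomes {..<n}. As nat carries the discrete topology, every function on it
   is continuous, so nat \<Rightarrow>\<^sub>C real consists of all bounded real sequences, with the sup norm. *)

type_synonym linf = "nat \<Rightarrow>\<^sub>C real"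

lemma bcontfun_nat: "bcontfun = {f :: nat \<Rightarrow> real. bounded (range f)}"
  by (auto simp: bcontfun_def)

lemma norm_linf: "norm (x :: linf) = (SUP n. \<bar>x n\<bar>)"
  by (simp add: norm_bcontfun_def dist_bcontfun.rep_eq zero_bcontfun.rep_eq)

(* The natural density of P exists and equals d. (The term n = 0 is 0 / 0 = 0 and irrelevant.) *)
definition has_density :: "nat set \<Rightarrow> real \<Rightarrow> bool" where
  "has_density P d \<longleftrightarrow> (\<lambda>n. real (card (P \<inter> {..<n})) / real n) \<longlonglongrightarrow> d"

definition almost_all :: "(nat \<Rightarrow> bool) \<Rightarrow> bool" where
  "almost_all P \<longleftrightarrow> has_density {k. \<not> P k} 0"

definition stat_converges :: "(nat \<Rightarrow> real) \<Rightarrow> real \<Rightarrow> bool" where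
  "stat_converges p l \<longleftrightarrow> (\<forall>\<epsilon>>0. has_density {k. \<bar>p k - l\<bar> > \<epsilon>} 0)"

definition stat_lim :: "(nat \<Rightarrow> real) \<Rightarrow> real" where
  "stat_lim p = (THE l. stat_converges p l)"

lemma stat_converges_unique:
  assumes "stat_converges p a" "stat_converges p b"
  shows "a = b"
proof (rule ccontr)
  assume "a \<noteq> b"
  define e where "e = \<bar>a - b\<bar> / 3"
  have e: "e > 0" using \<open>a \<noteq> b\<close> by (simp add: e_def)
  let ?A = "{k. \<bar>p k - a\<bar> > e}" and ?B = "{k. \<bar>p k - b\<bar> > e}"
  have "(\<lambda>n. real (card (?A \<inter> {..<n})) / real n + real (card (?B \<inter> {..<n})) / real n)
          \<longlonglongrightarrow> 0 + 0"
    using assms e unfolding stat_converges_def has_density_def by (intro tendsto_add) blast+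
  moreover have "1 \<le> real (card (?A \<inter> {..<n})) / real n + real (card (?B \<inter> {..<n})) / real n"
    if "n \<ge> 1" for n
  proof -
    have "k \<in> ?A \<union> ?B" for k
    proof -
      have "3 * e = \<bar>a - b\<bar>" by (simp add: e_def)
      then show ?thesis using e by auto
    qed
    then have "{..<n} = (?A \<inter> {..<n}) \<union> (?B \<inter> {..<n})" by blast
    then have "card {..<n} \<le> card (?A \<inter> {..<n}) + card (?B \<inter> {..<n})"
      by (metis card_Un_le)
    then have "real n \<le> real (card (?A \<inter> {..<n})) + real (card (?B \<inter> {..<n}))"
      by simp
    then show ?thesis using that by (simp add: field_simps)
  qed
  ultimately have "(1::real) \<le> 0 + 0"
    by (intro LIMSEQ_le_const) blast+
  then show False by simp
qed

lemma stat_lim_eq: "stat_converges p l \<Longrightarrow> stat_lim p = l"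
  unfolding stat_lim_def using stat_converges_unique by blast

definition st :: "linf set" where
  "st = {x. \<exists>l. stat_converges (apply_bcontfun x) l}"

definition shift :: "linf \<Rightarrow> linf" where
  "shift x = Bcontfun (\<lambda>n. x (Suc n))"

lemma apply_shift [simp]: "shift x n = x (Suc n)"
proof -
  have "bounded (range (\<lambda>n. x (Suc n)))"
    by (rule bounded_subset[OF bounded_apply_bcontfun[of x]]) auto
  then show ?thesis by (simp add: shift_def Bcontfun_inverse bcontfun_nat)
qed

(* onorm is a real-valued supremum, meaningful only for bounded operators; hence the explicit
   bounded_linear, which for a linear functional is part of having norm 1. In the last clause T
   is an arbitrary map, not assumed linear or continuous. *)
definition banach_stat_limit :: "(linf \<Rightarrow> real) \<Rightarrow> bool" where
  "banach_stat_limit F \<longleftrightarrow>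
     bounded_linear F \<and> onorm F = 1 \<and>
     (\<forall>x\<in>st. F x = stat_lim (apply_bcontfun x)) \<and>
     (\<forall>s :: linf. almost_all (\<lambda>n. apply_bcontfun s n \<ge> 0) \<longrightarrow> F s \<ge> 0) \<and>
     (\<forall>x :: linf. \<forall>T :: linf \<Rightarrow> linf.
        (\<forall>y :: linf. almost_all (\<lambda>k. apply_bcontfun (T y) k = apply_bcontfun (shift y) k)) \<longrightarrow> F x = F (T x))"

definition gas_converges :: "linf \<Rightarrow> real \<Rightarrow> bool" where
  "gas_converges x l \<longleftrightarrow> (\<forall>F. banach_stat_limit F \<longrightarrow> F x = l)"

definition GAS :: "linf set" where
  "GAS = {x. \<exists>l. gas_converges x l}"

end

theory Submission
  imports Defs "HOL-Real_Asymp.Real_Asymp"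
begin

text \<open>
  Closedness: a sequence is GAS convergent iff any two Banach statistical limits agree on it,
  so the set of these sequences is an intersection of kernels of the continuous functionals
  \<open>F - G\<close>.

  The topological failures all come from one uncountable uniformly separated family. The squares
  have density zero, so the indicator of any set of squares converges statistically to 0, and
  every Banach statistical limit sends it to 0. There are uncountably many sets of squares, and
  distinct indicators lie at distance at least 1 (\<open>gas_uncountable_separated\<close>). A metric space
  containing such a family is neither separable nor Lindelof, because a ball of radius 1/2
  meets the family in at most one point (\<open>countable_separated_if_balls_cover\<close>). Hence it is
  also neither second countable nor compact, while metrizability gives first countability.
\<close>

text \<open>Each ball of radius \<open>e / 2\<close> contains at most one point of the separated set, so choosing a
  ball around each point injects the set into the set of centres.\<close>

lemma countable_separated_if_balls_cover:
  fixes A :: "'a::metric_space set"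
  assumes sep: "\<And>x y. x \<in> A \<Longrightarrow> y \<in> A \<Longrightarrow> x \<noteq> y \<Longrightarrow> e \<le> dist x y"
    and C: "countable C" and cover: "A \<subseteq> (\<Union>c\<in>C. ball c (e / 2))"
  shows "countable A"
proof -
  have "\<forall>x\<in>A. \<exists>c\<in>C. dist c x < e / 2"
    using cover by fastforce
  then obtain h where h: "\<And>x. x \<in> A \<Longrightarrow> h x \<in> C \<and> dist (h x) x < e / 2"
    by metis
  have "inj_on h A"
  proof (rule inj_onI, rule ccontr)
    fix x y assume xy: "x \<in> A" "y \<in> A" "h x = h y" "x \<noteq> y"
    have "dist x y < e / 2 + e / 2"
      using h[OF xy(1)] h[OF xy(2)] xy(3) dist_triangle3[of x y "h x"] by simp
    then show False
      using sep[OF xy(1,2,4)] by simp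
  qed
  moreover have "h ` A \<subseteq> C"
    using h by blast
  ultimately show ?thesis
    using C countable_image_inj_on countable_subset by blast
qed

lemma not_separable_if_uncountable_separated:
  fixes A :: "'a::metric_space set"
  assumes "A \<subseteq> S" "uncountable A" "e > 0"
    and sep: "\<And>x y. x \<in> A \<Longrightarrow> y \<in> A \<Longrightarrow> x \<noteq> y \<Longrightarrow> e \<le> dist x y"
  shows "\<not> separable_space (top_of_set S)"
proof
  assume "separable_space (top_of_set S)"
  then obtain C where C: "countable C" "C \<subseteq> S" "top_of_set S closure_of C = S"
    by (auto simp: separable_space_def)
  have "S \<subseteq> closure C"
    using C(2,3) by (simp add: closure_of_subtopology inf_absorb2 inf.order_iff)
  then have "A \<subseteq> (\<Union>c\<in>C. ball c (e / 2))"
    using \<open>A \<subseteq> S\<close> \<open>e > 0\<close> closure_approachable[of _ C]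
    by (fastforce dest: spec[of _ "e / 2"])
  then show False
    using countable_separated_if_balls_cover[OF sep C(1)] \<open>uncountable A\<close> by blast
qed

lemma not_Lindelof_if_uncountable_separated:
  fixes A :: "'a::metric_space set"
  assumes "A \<subseteq> S" "uncountable A" "e > 0"
    and sep: "\<And>x y. x \<in> A \<Longrightarrow> y \<in> A \<Longrightarrow> x \<noteq> y \<Longrightarrow> e \<le> dist x y"
  shows "\<not> Lindelof_space (top_of_set S)"
proof
  assume L: "Lindelof_space (top_of_set S)"
  let ?B = "\<lambda>c. S \<inter> ball c (e / 2)"
  have "(\<forall>U \<in> ?B ` S. openin (top_of_set S) U) \<and> \<Union>(?B ` S) = topspace (top_of_set S)"
    using \<open>e > 0\<close> by (auto intro: openin_open_Int)
  then obtain V where V: "countable V" "V \<subseteq> ?B ` S" "\<Union>V = S"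
    using L unfolding Lindelof_space_def by (metis topspace_euclidean_subtopology)
  then obtain C where C: "countable C" "V = ?B ` C"
    by (meson countable_subset_image)
  have "A \<subseteq> (\<Union>c\<in>C. ball c (e / 2))"
    using \<open>A \<subseteq> S\<close> V(3) C(2) by blast
  then show False
    using countable_separated_if_balls_cover[OF sep C(1)] \<open>uncountable A\<close> by blast
qed

lemma has_density_zero_subset:
  assumes "has_density Q 0" "P \<subseteq> Q"
  shows "has_density P 0"
  unfolding has_density_def
proof (rule tendsto_sandwich[OF _ _ tendsto_const assms(1)[unfolded has_density_def]])
  have "card (P \<inter> {..<n}) \<le> card (Q \<inter> {..<n})" for n
    using assms(2) by (intro card_mono) auto
  then show "\<forall>\<^sub>F n in sequentially.
      real (card (P \<inter> {..<n})) / real n \<le> real (card (Q \<inter> {..<n})) / real n"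
    by (simp add: divide_right_mono)
qed simp

text \<open>There are about \<open>sqrt n\<close> squares below \<open>n\<close>, which is negligible against \<open>n\<close>.\<close>

lemma has_density_squares: "has_density (range (\<lambda>k. k\<^sup>2)) 0"
  unfolding has_density_def
proof (rule tendsto_sandwich[where h = "\<lambda>n. (sqrt (real n) + 1) / real n", OF _ _ tendsto_const])
  have "real (card (range (\<lambda>k. k\<^sup>2) \<inter> {..<n})) \<le> sqrt (real n) + 1" for n
  proof -
    have "k < nat \<lceil>sqrt (real n)\<rceil>" if "k\<^sup>2 < n" for k
    proof -
      have "real k < sqrt (real n)"
        using that by (intro real_less_rsqrt) (metis of_nat_less_iff of_nat_power)
      then show ?thesis by linarith
    qed
    then have "range (\<lambda>k. k\<^sup>2) \<inter> {..<n} \<subseteq> (\<lambda>k. k\<^sup>2) ` {..<nat \<lceil>sqrt (real n)\<rceil>}"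
      by auto
    then have "card (range (\<lambda>k. k\<^sup>2) \<inter> {..<n}) \<le> nat \<lceil>sqrt (real n)\<rceil>"
      by (metis card_lessThan finite_lessThan surj_card_le)
    moreover have "real (nat \<lceil>sqrt (real n)\<rceil>) \<le> sqrt (real n) + 1"
      using of_int_ceiling_le_add_one[of "sqrt (real n)"] by simp
    ultimately show ?thesis by linarith
  qed
  then show "\<forall>\<^sub>F n in sequentially. real (card (range (\<lambda>k. k\<^sup>2) \<inter> {..<n})) / real n
      \<le> (sqrt (real n) + 1) / real n"
    by (simp add: divide_right_mono)
  show "(\<lambda>n. (sqrt (real n) + 1) / real n) \<longlonglongrightarrow> 0"
    by real_asymp
qed simp

lemma gas_converges_if_density_zero_support:
  fixes x :: linf
  assumes "has_density {k. x k \<noteq> 0} 0"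
  shows "gas_converges x 0"
proof -
  have "stat_converges x 0"
    unfolding stat_converges_def
    by (auto intro!: has_density_zero_subset[OF assms])
  then show ?thesis
    by (auto simp: gas_converges_def banach_stat_limit_def st_def stat_lim_eq)
qed

definition indicator_seq :: "nat set \<Rightarrow> linf" where
  "indicator_seq P = Bcontfun (indicator P)"

lemma apply_indicator_seq [simp]: "indicator_seq P n = indicator P n"
proof -
  have "bounded (range (indicator P :: nat \<Rightarrow> real))"
    by (rule boundedI[of _ 1]) (auto simp: indicator_def)
  then show ?thesis
    by (simp add: indicator_seq_def Bcontfun_inverse bcontfun_nat)
qed

lemma dist_indicator_seq:
  assumes "P \<noteq> Q"
  shows "1 \<le> dist (indicator_seq P) (indicator_seq Q)"
proof -
  obtain n where "(n \<in> P) \<noteq> (n \<in> Q)"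
    using assms by blast
  then have "dist (indicator_seq P n) (indicator_seq Q n) = 1"
    by (auto simp: dist_real_def indicator_def)
  then show ?thesis
    by (metis dist_bounded)
qed

lemma uncountable_UNIV_nat_set: "uncountable (UNIV :: nat set set)"
proof
  assume "countable (UNIV :: nat set set)"
  then have "range (from_nat_into (UNIV :: nat set set)) = Pow UNIV"
    by (simp add: range_from_nat_into)
  then show False
    using Cantors_theorem by blast
qed

lemma gas_uncountable_separated:
  obtains A :: "linf set" where "A \<subseteq> GAS" "uncountable A"
    "\<And>x y. x \<in> A \<Longrightarrow> y \<in> A \<Longrightarrow> x \<noteq> y \<Longrightarrow> 1 \<le> dist x y"
proof -
  define f where "f M = indicator_seq ((\<lambda>k. k\<^sup>2) ` M)" for M :: "nat set"
  have sep: "1 \<le> dist (f M) (f N)" if "M \<noteq> N" for M N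
  proof -
    have "inj (\<lambda>k::nat. k\<^sup>2)"
      by (simp add: inj_def)
    then show ?thesis
      using that unfolding f_def by (intro dist_indicator_seq) (simp add: inj_image_eq_iff)
  qed
  show ?thesis
  proof
    show "range f \<subseteq> GAS"
    proof clarify
      fix M
      have "{k. f M k \<noteq> 0} \<subseteq> range (\<lambda>k. k\<^sup>2)"
        by (auto simp: f_def indicator_def)
      then show "f M \<in> GAS"
        using gas_converges_if_density_zero_support has_density_zero_subset has_density_squares
        unfolding GAS_def by blast
    qed
    have "inj f"
      using sep by (metis dist_self injI not_one_le_zero)
    then show "uncountable (range f)"
      using uncountable_UNIV_nat_set countable_image_inj_on by blast
    show "1 \<le> dist x y" if "x \<in> range f" "y \<in> range f" "x \<noteq> y" for x y
      using that sep by (metis rangeE)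
  qed
qed

text \<open>Comparing the functionals with each other removes the unknown limit from the description. If
  there were no Banach statistical limit, both sides would be the whole space.\<close>

lemma GAS_eq_Inter:
  "GAS = (\<Inter>F\<in>Collect banach_stat_limit. \<Inter>G\<in>Collect banach_stat_limit. {x. F x = G x})"
  unfolding GAS_def gas_converges_def by (auto, metis)

lemma closed_GAS: "closed GAS"
proof -
  have "continuous_on UNIV F" if "banach_stat_limit F" for F
    using that by (simp add: banach_stat_limit_def linear_continuous_on)
  then show ?thesis
    unfolding GAS_eq_Inter by (auto intro!: closed_INT closed_Collect_eq)
qed

theorem proposition3p5:
  shows "closed GAS \<and>
    \<not> separable_space (top_of_set GAS) \<and>
    (first_countable (top_of_set GAS) \<and> \<not> second_countable (top_of_set GAS)) \<and>
    (\<not> Lindelof_space (top_of_set GAS) \<and> \<not> compact_space (top_of_set GAS))"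
proof -
  obtain A :: "linf set" where A: "A \<subseteq> GAS" "uncountable A"
    "\<And>x y. x \<in> A \<Longrightarrow> y \<in> A \<Longrightarrow> x \<noteq> y \<Longrightarrow> 1 \<le> dist x y"
    by (fact gas_uncountable_separated)
  have sep: "\<not> separable_space (top_of_set GAS)"
    using not_separable_if_uncountable_separated[OF A(1,2) zero_less_one A(3)] .
  have Lind: "\<not> Lindelof_space (top_of_set GAS)"
    using not_Lindelof_if_uncountable_separated[OF A(1,2) zero_less_one A(3)] .
  have "first_countable (top_of_set GAS)"
    by (intro metrizable_imp_first_countable metrizable_space_subtopology
        metrizable_space_euclidean)
  then show ?thesis
    using closed_GAS sep Lind second_countable_imp_separable_space compact_imp_Lindelof_space
    by blast
qed

end
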